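(* Let $m\ge2$ and, for $n_1,\ldots,n_m\in\mathbb{N}_{\ge1}$, let $$\pi_1(n_1,\ldots,n_m)=\mathbb{P}(A_2\le n_2-1,\ldots,A_m\le n_m-1),$$ where $(A_2,\ldots,A_m)$ has a negative multinomial distribution with parameters $(n_1;p_2,\ldots,p_m)$, $p_\ell=\frac{n_\ell}{n_1+\cdots+n_m}$. Let $(X_2,\ldots,X_m)\sim\operatorname{ID}(n_2,\ldots,n_m;n_1)$. Then, for fixed $n_1,\ldots,n_{m-1}\in\mathbb{N}_{\ge1}$, $$\lim_{n_m\to\infty}\pi_1(n_1,n_2,\ldots,n_m)=\int_{\frac{n_2}{n_1}}^\infty\cdots\int_{\frac{n_{m-1}}{n_1}}^\infty\int_0^{n_1\left(1+\sum_{k=2}^{m-1}s_k\right)}f_\Gamma(s_m)\,ds_m\ \varphi_{<m}(s_2,\ldots,s_{m-1})\,ds_{m-1}\cdots ds_2,$$ where $\varphi_{<m}$ is the marginal density of $(X_2,\ldots,X_{m-1})$ and $f_\Gamma$ is the density of the $\operatorname{Gamma}\big(\sum_{k=1}^{m-1}n_k,1\big)$ distribution. (For $m=2$ the outer integrals and the factor $\varphi_{<m}$ are absent.)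
   Context: Negative multinomial distribution with parameters $(n_1;p_2,\ldots,p_m)$, with $p_1:=1-\sum_{k=2}^m p_k>0$: for all integers $k_2,\ldots,k_m\ge0$, $$\mathbb{P}(A_2=k_2,\ldots,A_m=k_m)=\frac{(n_1+k_2+\cdots+k_m-1)!}{(n_1-1)!\,k_2!\cdots k_m!}\,p_1^{n_1}\prod_{\ell=2}^m p_\ell^{k_\ell}.$$ Inverted Dirichlet distribution $\operatorname{ID}(n_2,\ldots,n_m;n_1)$: the distribution on $[0,\infty)^{m-1}$ with density $$(s_2,\ldots,s_m)\mapsto\frac{\Gamma\big(\sum_{k=1}^m n_k\big)}{\prod_{k=1}^m\Gamma(n_k)}\cdot\frac{\prod_{k=2}^m s_k^{n_k-1}}{\big(1+\sum_{k=2}^m s_k\big)^{\sum_{k=1}^m n_k}}.$$ The marginal $(X_2,\ldots,X_{m-1})$ has distribution $\operatorname{ID}(n_2,\ldots,n_{m-1};n_1)$, so $\varphi_{<m}$ is the density of that distribution and does not depend on $n_m$. $\operatorname{Gamma}(a,1)$ is the distribution on $(0,\infty)$ with density $x^{a-1}e^{-x}/\Gamma(a)$. *)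

theory Defs
  imports "HOL-Probability.Probability"
begin

text \<open>
  A vector \<open>(x\<^sub>2, \<dots>, x\<^sub>m)\<close> is an element of \<open>{2..m} \<rightarrow>\<^sub>E UNIV\<close>. Parameters \<open>n\<^sub>1, \<dots>, n\<^sub>m\<close> and
  \<open>p\<^sub>2, \<dots>, p\<^sub>m\<close> are functions on \<open>nat\<close>, of which only the values at the indicated indices matter.
\<close>

definition neg_multinomial_mass :: "nat \<Rightarrow> nat \<Rightarrow> (nat \<Rightarrow> real) \<Rightarrow> (nat \<Rightarrow> nat) \<Rightarrow> real" where
  "neg_multinomial_mass m n1 p k =
     fact (n1 + (\<Sum>l=2..m. k l) - 1) / (fact (n1 - 1) * (\<Prod>l=2..m. fact (k l)))
       * (1 - (\<Sum>l=2..m. p l)) ^ n1 * (\<Prod>l=2..m. p l ^ k l)"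

definition neg_multinomial :: "nat \<Rightarrow> nat \<Rightarrow> (nat \<Rightarrow> real) \<Rightarrow> (nat \<Rightarrow> nat) measure" where
  "neg_multinomial m n1 p =
     density (count_space ({2..m} \<rightarrow>\<^sub>E UNIV)) (\<lambda>k. ennreal (neg_multinomial_mass m n1 p k))"

definition pi1 :: "nat \<Rightarrow> (nat \<Rightarrow> nat) \<Rightarrow> real" where
  "pi1 m n =
     \<P>(A in neg_multinomial m (n 1) (\<lambda>l. real (n l) / real (\<Sum>j=1..m. n j)).
        \<forall>l\<in>{2..m}. A l \<le> n l - 1)"

definition inverted_dirichlet_density :: "nat \<Rightarrow> (nat \<Rightarrow> nat) \<Rightarrow> (nat \<Rightarrow> real) \<Rightarrow> real" where
  "inverted_dirichlet_density m n s =
     (if \<forall>k\<in>{2..m}. 0 \<le> s k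
      then Gamma (real (\<Sum>k=1..m. n k)) / (\<Prod>k=1..m. Gamma (real (n k)))
             * ((\<Prod>k=2..m. s k ^ (n k - 1)) / (1 + (\<Sum>k=2..m. s k)) ^ (\<Sum>k=1..m. n k))
      else 0)"

definition gamma_density :: "real \<Rightarrow> real \<Rightarrow> real" where
  "gamma_density a x = (if 0 < x then x powr (a - 1) * exp (- x) / Gamma a else 0)"

end

theory Submission
  imports Defs
begin

text \<open>
  Mixing independent Poisson variables of means \<open>g n\<^sub>l / n\<^sub>1\<close> over a \<open>Gamma(n\<^sub>1, 1)\<close> variable \<open>g\<close>
  yields the negative multinomial distribution, so \<open>\<pi>\<^sub>1\<close> is the integral over \<open>g\<close> of a product of
  Poisson distribution functions. As \<open>n\<^sub>m \<rightarrow> \<infinity>\<close> the factor of index \<open>m\<close> concentrates (Chernoff) to the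
  indicator of \<open>g < n\<^sub>1\<close>, and dominated convergence gives the limit as an integral over \<open>g\<close>.
  The other factors are tails of \<open>Gamma(n\<^sub>l, g)\<close> variables \<open>s\<^sub>l\<close>; the joint density of \<open>g\<close> and the \<open>s\<^sub>l\<close>
  is the inverted Dirichlet density in \<open>s\<close> times the Gamma density of rate \<open>1 + \<Sum> s\<^sub>l\<close> in \<open>g\<close>, and
  Fubini yields the claimed integral. The same factorization identifies the marginal density \<open>\<phi>\<close>.
\<close>

section \<open>Poisson distribution functions: \<open>poisson_lt j x\<close> is the probability of
  fewer than \<open>j\<close> events at mean \<open>x\<close>\<close>

definition poisson_lt :: "nat \<Rightarrow> real \<Rightarrow> real" where
  "poisson_lt j x = (\<Sum>i<j. x ^ i * exp (- x) / fact i)"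

lemma poisson_lt_nonneg: "0 \<le> x \<Longrightarrow> 0 \<le> poisson_lt j x"
  by (auto simp: poisson_lt_def intro!: sum_nonneg)

text \<open>Poisson process duality: the arrival number \<open>Suc k\<close> comes after time
  \<open>x\<close> exactly when fewer than \<open>Suc k\<close> events occur up to
  \<open>x\<close>.\<close>

lemma erlang_CDF_eq_poisson_lt: "0 \<le> x \<Longrightarrow> erlang_CDF k l x = 1 - poisson_lt (Suc k) (l * x)"
  by (simp add: erlang_CDF_def poisson_lt_def lessThan_Suc_atMost)

lemma poisson_lt_le_1:
  assumes "0 \<le> x" shows "poisson_lt j x \<le> 1"
proof (cases j)
  case (Suc k)
  have "0 \<le> erlang_CDF k 1 x" by simp
  then show ?thesis using assms Suc by (simp add: erlang_CDF_eq_poisson_lt del: erlang_CDF_nonneg)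
qed (simp add: poisson_lt_def)

lemma borel_measurable_poisson_lt [measurable]: "poisson_lt j \<in> borel_measurable borel"
  unfolding poisson_lt_def by measurable

lemma exp_sums: "(\<lambda>i. x ^ i / fact i) sums exp (x::real)"
  using exp_converges[of x] by (simp add: divide_inverse mult.commute)

text \<open>Since \<open>c\<close> is at least 1, every factor \<open>c ^ i\<close> with
  \<open>i < N\<close> is at most \<open>c ^ N\<close>; what remains is a partial sum of the series
  of \<open>exp (real N)\<close>.\<close>

lemma poisson_lt_le_chernoff:
  assumes "1 \<le> c"
  shows "poisson_lt N (real N * c) \<le> (c * exp (1 - c)) ^ N"
proof -
  have "(\<Sum>i<N. (real N * c) ^ i / fact i) \<le> (\<Sum>i<N. c ^ N * (real N ^ i / fact i))"
  proof (intro sum_mono)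
    fix i assume "i \<in> {..<N}"
    then have "c ^ i * (real N ^ i / fact i) \<le> c ^ N * (real N ^ i / fact i)"
      using assms by (intro mult_right_mono power_increasing) auto
    then show "(real N * c) ^ i / fact i \<le> c ^ N * (real N ^ i / fact i)"
      by (simp add: power_mult_distrib mult.commute)
  qed
  also have "\<dots> = c ^ N * (\<Sum>i<N. real N ^ i / fact i)"
    by (simp add: sum_distrib_left)
  also have "\<dots> \<le> c ^ N * exp (real N)"
    using assms exp_sums[of "real N"]
    by (intro mult_left_mono sum_le_suminf[THEN order_trans]) (auto simp: sums_iff)
  finally have "(\<Sum>i<N. (real N * c) ^ i / fact i) * exp (- (real N * c)) \<le> c ^ N * exp (real N) * exp (- (real N * c))"
    by (rule mult_right_mono) simp
  moreover have "poisson_lt N (real N * c) = (\<Sum>i<N. (real N * c) ^ i / fact i) * exp (- (real N * c))"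
    by (simp add: poisson_lt_def sum_distrib_right)
  moreover have "c ^ N * exp (real N) * exp (- (real N * c)) = (c * exp (1 - c)) ^ N"
    by (simp add: power_mult_distrib exp_add[symmetric] exp_of_nat_mult[symmetric] algebra_simps)
  ultimately show ?thesis by simp
qed

text \<open>The mirror image, applied to the terms of index at least \<open>N\<close>: now
  \<open>c\<close> is at most 1, so \<open>c ^ N\<close> again dominates and the rest is a tail of
  the series of \<open>exp (real N)\<close>.\<close>

lemma poisson_lt_ge_chernoff:
  assumes "0 \<le> c" "c \<le> 1"
  shows "1 - (c * exp (1 - c)) ^ N \<le> poisson_lt N (real N * c)"
proof -
  define f where "f i = (real N * c) ^ i / fact i" for i
  define h where "h i = real N ^ i / fact i" for i
  have f: "f sums exp (real N * c)" unfolding f_def by (rule exp_sums)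
  have h: "h sums exp (real N)" unfolding h_def by (rule exp_sums)
  have "exp (real N * c) - sum f {..<N} = (\<Sum>i. f (i + N))"
    using f by (simp add: sums_iff suminf_minus_initial_segment)
  also have "\<dots> \<le> (\<Sum>i. c ^ N * h (i + N))"
  proof (intro suminf_le summable_mult)
    fix i
    have "c ^ (i + N) * h (i + N) \<le> c ^ N * h (i + N)"
      using assms by (intro mult_right_mono power_decreasing) (auto simp: h_def)
    then show "f (i + N) \<le> c ^ N * h (i + N)"
      unfolding f_def h_def by (simp add: power_mult_distrib mult.commute)
  qed (use f h in \<open>simp_all add: sums_iff summable_iff_shift\<close>)
  also have "\<dots> = c ^ N * (\<Sum>i. h (i + N))"
    using h by (intro suminf_mult) (simp add: sums_iff summable_iff_shift)
  also have "\<dots> \<le> c ^ N * exp (real N)"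
  proof -
    have "(\<Sum>i. h (i + N)) = exp (real N) - sum h {..<N}"
      using h by (simp add: sums_iff suminf_minus_initial_segment)
    moreover have "0 \<le> sum h {..<N}" unfolding h_def by (intro sum_nonneg) simp
    ultimately show ?thesis using assms by (intro mult_left_mono) auto
  qed
  finally have "(exp (real N * c) - sum f {..<N}) * exp (- (real N * c)) \<le> c ^ N * exp (real N) * exp (- (real N * c))"
    by (rule mult_right_mono) simp
  moreover have "poisson_lt N (real N * c) = sum f {..<N} * exp (- (real N * c))"
    by (simp add: poisson_lt_def f_def sum_distrib_right)
  moreover have "c ^ N * exp (real N) * exp (- (real N * c)) = (c * exp (1 - c)) ^ N"
    by (simp add: power_mult_distrib mult.assoc exp_add[symmetric]
        exp_of_nat_mult[symmetric] algebra_simps)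
  ultimately show ?thesis
    by (simp add: left_diff_distrib exp_add[symmetric])
qed

text \<open>Law of large numbers for Poisson variables. The critical value \<open>c = 1\<close>,
  where the limit would be 1/2, is left out; in the application it corresponds to the single point
  \<open>g = n 1\<close>.\<close>

lemma poisson_lt_tendsto:
  assumes "0 \<le> c" "c \<noteq> 1"
  shows "(\<lambda>N. poisson_lt N (real N * c)) \<longlonglongrightarrow> (if c < 1 then 1 else 0)"
proof -
  \<comment> \<open>Strict concavity of \<open>ln\<close> away from 1 makes the Chernoff base
    \<open>c * exp (1 - c)\<close> strictly smaller than 1.\<close>
  have "c < exp (c - 1)"
  proof (cases "c = 0")
    case False
    then have "ln c < c - 1"
      using assms ln_le_minus_one[of c] ln_eq_minus_one[of c] by force
    then show ?thesis
      using False assms exp_less_mono[of "ln c" "c - 1"] by simp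
  qed simp
  then have "c * exp (1 - c) < 1"
    using mult_strict_right_mono[of c "exp (c - 1)" "exp (1 - c)"] by (simp add: exp_add[symmetric])
  then have lim: "(\<lambda>N. (c * exp (1 - c)) ^ N) \<longlonglongrightarrow> 0"
    using assms by (intro LIMSEQ_realpow_zero) auto
  show ?thesis
  proof (cases "c < 1")
    case True
    have "(\<lambda>N. poisson_lt N (real N * c)) \<longlonglongrightarrow> 1"
    proof (rule tendsto_sandwich)
      show "(\<lambda>N. 1 - (c * exp (1 - c)) ^ N) \<longlonglongrightarrow> 1"
        using tendsto_diff[OF tendsto_const[of 1] lim] by simp
      show "(\<lambda>_. 1::real) \<longlonglongrightarrow> 1" by (rule tendsto_const)
    qed (use True assms poisson_lt_ge_chernoff poisson_lt_le_1 in \<open>auto intro!: always_eventually\<close>)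
    then show ?thesis using True by simp
  next
    case False
    have "(\<lambda>N. poisson_lt N (real N * c)) \<longlonglongrightarrow> 0"
      using False assms poisson_lt_le_chernoff[of c]
      by (intro tendsto_sandwich[OF _ _ tendsto_const lim] always_eventually)
        (auto intro!: poisson_lt_nonneg)
    then show ?thesis using False by simp
  qed
qed

section \<open>Gamma densities of integer shape: \<open>erlang_density k l\<close> has shape
  \<open>k + 1\<close> and rate \<open>l\<close>\<close>

lemma nn_integral_erlang_density_UNIV:
  "0 < l \<Longrightarrow> (\<integral>\<^sup>+x. ennreal (erlang_density k l x) \<partial>lborel) = 1"
  using nn_integral_erlang_ith_moment[of l k 0] by simp

text \<open>The duality above, read for the upper tail. The complement of \<open>{..q}\<close> is
  the open ray, and adding its endpoint changes nothing.\<close>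

lemma nn_integral_erlang_density_atLeast:
  assumes "0 < l" "0 \<le> q"
  shows "(\<integral>\<^sup>+x. ennreal (erlang_density k l x) * indicator {q..} x \<partial>lborel) = ennreal (poisson_lt (Suc k) (l * q))"
proof -
  interpret D: prob_space "density lborel (erlang_density k l)"
    using assms by (intro prob_space_erlang_density)
  have "measure (density lborel (erlang_density k l)) {..q} = erlang_CDF k l q"
    using assms by (simp add: measure_def emeasure_erlang_density)
  then have "D.prob {q<..} = poisson_lt (Suc k) (l * q)"
    using D.prob_compl[of "{..q}"] assms
    by (simp add: Compl_eq_Diff_UNIV[symmetric] erlang_CDF_eq_poisson_lt)
  then have "ennreal (poisson_lt (Suc k) (l * q)) = (\<integral>\<^sup>+x. ennreal (erlang_density k l x) * indicator {q<..} x \<partial>lborel)"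
    by (subst emeasure_density[symmetric]) (simp_all add: D.emeasure_eq_measure)
  also have "\<dots> = (\<integral>\<^sup>+x. ennreal (erlang_density k l x) * indicator {q..} x \<partial>lborel)"
    using AE_lborel_singleton[of q]
    by (intro nn_integral_cong_AE) (auto split: split_indicator elim!: eventually_mono)
  finally show ?thesis by simp
qed

section \<open>Two factorizations of joint densities with a Gamma variable\<close>

lemma Gamma_of_nat: "1 \<le> k \<Longrightarrow> Gamma (real k) = fact (k - 1)"
  using Gamma_fact[of "k - 1", where 'a=real] by (simp add: of_nat_diff)

lemma
  fixes m :: nat
  assumes "1 \<le> m"
  shows sum_1_eq: "(\<Sum>k=1..m. f k) = f 1 + (\<Sum>k=2..m. f k)"
    and prod_1_eq: "(\<Prod>k=1..m. h k) = h 1 * (\<Prod>k=2..m. h k)"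
  using sum.atLeast_Suc_atMost[of 1 m f] prod.atLeast_Suc_atMost[of 1 m h] assms
  by (simp_all add: numeral_2_eq_2)

text \<open>Both sides are the joint density of \<open>g\<close> and \<open>s\<close>, disintegrated
  in either order: \<open>s\<close> given \<open>g\<close> on the left, \<open>g\<close> given
  \<open>s\<close> on the right. The exponentials combine to rate
  \<open>1 + (\<Sum>k=2..m. s k)\<close>, and the powers of \<open>g\<close> to the total shape. A
  negative coordinate makes both sides zero.\<close>

lemma erlang_density_prod_eq_inverted_dirichlet:
  assumes "1 \<le> m" "\<And>k. k \<in> {1..m} \<Longrightarrow> 1 \<le> n k" "0 < g"
  shows "erlang_density (n 1 - 1) 1 g * (\<Prod>k=2..m. erlang_density (n k - 1) g (s k)) =
    inverted_dirichlet_density m n s *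
      erlang_density ((\<Sum>k=1..m. n k) - 1) (1 + (\<Sum>k=2..m. s k)) g"
proof (cases "\<forall>k\<in>{2..m}. 0 \<le> s k")
  case False
  then show ?thesis
    by (auto simp: inverted_dirichlet_density_def erlang_density_def not_le prod_zero_iff)
next
  case True
  define T where "T = (\<Sum>k=2..m. n k)"
  define L where "L = 1 + (\<Sum>k=2..m. s k)"
  have "0 \<le> (\<Sum>k=2..m. s k)" using True by (intro sum_nonneg) auto
  then have L: "0 < L" by (simp add: L_def)
  have n1: "1 \<le> n 1" using assms by auto
  have S: "(\<Sum>k=1..m. n k) = n 1 + T" using assms(1) by (simp only: sum_1_eq T_def)
  have "(\<Prod>k=2..m. erlang_density (n k - 1) g (s k)) =
      (\<Prod>k=2..m. g ^ n k * s k ^ (n k - 1) * exp (- (g * s k)) / fact (n k - 1))"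
  proof (intro prod.cong refl)
    fix k assume "k \<in> {2..m}"
    then show "erlang_density (n k - 1) g (s k) = g ^ n k * s k ^ (n k - 1) * exp (- (g * s k)) / fact (n k - 1)"
      using bspec[OF True, of k] assms(2)[of k] by (cases "n k") (auto simp: erlang_density_def not_less)
  qed
  also have "\<dots> = g ^ T * (\<Prod>k=2..m. s k ^ (n k - 1)) * exp (- (g * (L - 1))) / (\<Prod>k=2..m. fact (n k - 1))"
    by (simp add: prod.distrib prod_dividef power_sum T_def L_def exp_sum[symmetric] sum_distrib_left sum_negf)
  finally have 1: "(\<Prod>k=2..m. erlang_density (n k - 1) g (s k)) =
     g ^ T * (\<Prod>k=2..m. s k ^ (n k - 1)) * exp (- (g * (L - 1))) / (\<Prod>k=2..m. fact (n k - 1))" .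
  have G: "(\<Prod>k=2..m. Gamma (real (n k))) = (\<Prod>k=2..m. fact (n k - 1))"
    using assms(2) by (intro prod.cong refl Gamma_of_nat) auto
  have G1: "Gamma (real (n 1)) = fact (n 1 - 1)" using n1 by (rule Gamma_of_nat)
  have G2: "Gamma (real (n 1 + T)) = fact (n 1 + T - 1)" using n1 by (intro Gamma_of_nat) simp
  have 2: "inverted_dirichlet_density m n s =
    fact (n 1 + T - 1) / (fact (n 1 - 1) * (\<Prod>k=2..m. fact (n k - 1))) *
     ((\<Prod>k=2..m. s k ^ (n k - 1)) / L ^ (n 1 + T))"
    unfolding inverted_dirichlet_density_def S G2
    using True assms(1) by (simp only: prod_1_eq G G1 L_def) simp
  have 3: "erlang_density (n 1 + T - 1) L g = L ^ (n 1 + T) * (g ^ T * g ^ (n 1 - 1)) * exp (- (L * g)) / fact (n 1 + T - 1)"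
    using assms(3) n1 by (simp add: erlang_density_def power_add[symmetric] add.commute)
  have 4: "erlang_density (n 1 - 1) 1 g = g ^ (n 1 - 1) * exp (- g) / fact (n 1 - 1)"
    using assms(3) by (simp add: erlang_density_def)
  have 5: "exp (- (L * g)) = exp (- g) * exp (- (g * (L - 1)))"
    by (simp add: exp_add[symmetric] algebra_simps)
  show ?thesis
    unfolding S L_def[symmetric] 1 2 3 4 5 using L by (simp add: field_simps)
qed

text \<open>The discrete counterpart, a Bayes identity: the mass of the counts times the density of
  \<open>g\<close> given the counts equals the density of \<open>g\<close> times the Poisson
  likelihood of the counts.\<close>

lemma neg_multinomial_mass_mult_erlang_density:
  assumes "1 \<le> n1" "\<And>l. l \<in> {2..m} \<Longrightarrow> 0 \<le> q l" "0 < g"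
  shows "neg_multinomial_mass m n1 (\<lambda>l. q l / (1 + (\<Sum>j=2..m. q j))) k *
      erlang_density (n1 + (\<Sum>l=2..m. k l) - 1) (1 + (\<Sum>l=2..m. q l)) g =
    erlang_density (n1 - 1) 1 g * (\<Prod>l=2..m. (g * q l) ^ k l * exp (- (g * q l)) / fact (k l))"
proof -
  define T where "T = (\<Sum>l=2..m. k l)"
  define L where "L = 1 + (\<Sum>l=2..m. q l)"
  have "0 \<le> (\<Sum>l=2..m. q l)" using assms by (intro sum_nonneg) auto
  then have L: "0 < L" by (simp add: L_def)
  have 1: "(\<Prod>l=2..m. (g * q l) ^ k l * exp (- (g * q l)) / fact (k l)) =
     g ^ T * (\<Prod>l=2..m. q l ^ k l) * exp (- (g * (L - 1))) / (\<Prod>l=2..m. fact (k l))"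
    by (simp add: prod.distrib prod_dividef power_sum power_mult_distrib T_def L_def exp_sum[symmetric] sum_distrib_left sum_negf)
  \<comment> \<open>This is the remaining probability p_1; its power \<open>n1\<close> and the
    denominators of the other p_l combine to \<open>L ^ (n1 + T)\<close>, which cancels the rate
    factor of the Erlang density.\<close>
  have "1 - (\<Sum>l=2..m. q l / L) = 1 / L"
    using L by (simp add: sum_divide_distrib[symmetric] L_def field_simps)
  then have 2: "neg_multinomial_mass m n1 (\<lambda>l. q l / L) k =
    fact (n1 + T - 1) / (fact (n1 - 1) * (\<Prod>l=2..m. fact (k l))) * ((\<Prod>l=2..m. q l ^ k l) / L ^ (n1 + T))"
    by (simp add: neg_multinomial_mass_def T_def power_divide prod_dividef power_sum power_add)
  have 3: "erlang_density (n1 + T - 1) L g = L ^ (n1 + T) * (g ^ T * g ^ (n1 - 1)) * exp (- (L * g)) / fact (n1 + T - 1)"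
    using assms(1,3) by (simp add: erlang_density_def power_add[symmetric] add.commute)
  have 4: "erlang_density (n1 - 1) 1 g = g ^ (n1 - 1) * exp (- g) / fact (n1 - 1)"
    using assms(3) by (simp add: erlang_density_def)
  have 5: "exp (- (L * g)) = exp (- g) * exp (- (g * (L - 1)))"
    by (simp add: exp_add[symmetric] algebra_simps)
  show ?thesis
    unfolding L_def[symmetric] T_def[symmetric] 1 2 3 4 5 using L by (simp add: field_simps)
qed

section \<open>\<open>pi1\<close> as a Gamma mixture of products of Poisson distribution
  functions\<close>

lemma has_bochner_integral_erlang_density:
  "0 < l \<Longrightarrow> has_bochner_integral lborel (erlang_density k l) 1"
  by (intro has_bochner_integral_nn_integral) (auto simp: nn_integral_erlang_density_UNIV)

text \<open>Integrating the Bayes identity over \<open>g\<close> removes the conditional density of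
  \<open>g\<close>, so each mass is a mixed Poisson probability. Summing over the box of admissible
  counts turns the product of Poisson masses into a product of distribution functions.\<close>

lemma has_bochner_integral_pi1:
  assumes "1 \<le> m" "\<And>k. k \<in> {1..m} \<Longrightarrow> 1 \<le> n k"
  shows "has_bochner_integral lborel
    (\<lambda>g. erlang_density (n 1 - 1) 1 g * (\<Prod>l=2..m. poisson_lt (n l) (g * (real (n l) / real (n 1)))))
    (pi1 m n)"
proof -
  define q where "q l = real (n l) / real (n 1)" for l
  define L where "L = 1 + (\<Sum>l=2..m. q l)"
  define P where "P = neg_multinomial_mass m (n 1) (\<lambda>l. q l / L)"
  define B where "B = (\<Pi>\<^sub>E l\<in>{2..m}. {..<n l})"
  have n1: "1 \<le> n 1" using assms by auto
  have q: "0 \<le> q l" for l by (simp add: q_def)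
  have sq: "0 \<le> (\<Sum>l=2..m. q l)" using q by (intro sum_nonneg) auto
  then have L: "0 < L" by (simp add: L_def)
  \<comment> \<open>Dividing all parameters by \<open>n 1\<close> brings the p_l of the statement
    into the form \<open>q l / L\<close> of the Bayes identity.\<close>
  have nL: "real (\<Sum>j=1..m. n j) = real (n 1) * L"
    using n1 unfolding sum_1_eq[OF assms(1)] L_def q_def
    by (simp add: sum_divide_distrib[symmetric] field_simps)
  have p: "real (n l) / real (\<Sum>j=1..m. n j) = q l / L" for l
    unfolding nL by (simp add: q_def)
  have "(\<Sum>l=2..m. q l / L) \<le> 1"
    using L by (simp add: sum_divide_distrib[symmetric] divide_le_eq_1 L_def)
  then have P_nonneg: "0 \<le> P k" for k
    using q L by (simp add: P_def neg_multinomial_mass_def prod_nonneg)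
  have fin: "finite B" unfolding B_def by (intro finite_PiE) auto
  have "{k \<in> {2..m} \<rightarrow>\<^sub>E UNIV. \<forall>l\<in>{2..m}. k l \<le> n l - 1} = B"
  proof -
    \<comment> \<open>Truncated subtraction is harmless here because each \<open>n l\<close> is at
      least 1.\<close>
    have "(\<forall>l\<in>{2..m}. k l \<le> n l - 1) \<longleftrightarrow> (\<forall>l\<in>{2..m}. k l < n l)" for k :: "nat \<Rightarrow> nat"
    proof (intro ball_cong refl)
      fix l assume "l \<in> {2..m}"
      then show "k l \<le> n l - 1 \<longleftrightarrow> k l < n l" using assms(2)[of l] by auto
    qed
    then show ?thesis by (auto simp: B_def PiE_iff extensional_def)
  qed
  then have "pi1 m n = measure (neg_multinomial m (n 1) (\<lambda>l. q l / L)) B"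
    unfolding pi1_def p by (simp add: neg_multinomial_def)
  also have "\<dots> = (\<Sum>k\<in>B. P k)"
  proof -
    have "emeasure (neg_multinomial m (n 1) (\<lambda>l. q l / L)) B =
        (\<integral>\<^sup>+k. ennreal (P k) * indicator B k \<partial>count_space ({2..m} \<rightarrow>\<^sub>E UNIV))"
      unfolding neg_multinomial_def P_def by (subst emeasure_density) (auto simp: B_def PiE_iff)
    also have "\<dots> = (\<Sum>k\<in>B. ennreal (P k) * indicator B k)"
      using fin by (intro nn_integral_count_space') (auto simp: B_def PiE_iff)
    also have "\<dots> = ennreal (\<Sum>k\<in>B. P k)"
      using P_nonneg by (simp add: sum_ennreal)
    finally show ?thesis
      using P_nonneg by (simp add: measure_def sum_nonneg)
  qed
  finally have pi1: "pi1 m n = (\<Sum>k\<in>B. P k)" .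
  have "has_bochner_integral lborel
      (\<lambda>g. erlang_density (n 1 - 1) 1 g * (\<Prod>l=2..m. (g * q l) ^ k l * exp (- (g * q l)) / fact (k l))) (P k)" for k
  proof -
    have "has_bochner_integral lborel (\<lambda>g. P k * erlang_density (n 1 + (\<Sum>l=2..m. k l) - 1) L g) (P k * 1)"
      by (intro has_bochner_integral_mult_right has_bochner_integral_erlang_density L)
    \<comment> \<open>The Bayes identity is available for positive \<open>g\<close>. Both sides
      vanish for negative \<open>g\<close>, and the point 0 is null.\<close>
    moreover have "AE g in lborel. P k * erlang_density (n 1 + (\<Sum>l=2..m. k l) - 1) L g =
        erlang_density (n 1 - 1) 1 g * (\<Prod>l=2..m. (g * q l) ^ k l * exp (- (g * q l)) / fact (k l))"
      using AE_lborel_singleton[of 0]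
    proof eventually_elim
      case (elim g)
      show ?case
      proof (cases "g < 0")
        case True
        then show ?thesis by (simp add: erlang_density_def)
      next
        case False
        with elim have "0 < g" by simp
        from neg_multinomial_mass_mult_erlang_density[where q=q and k=k, OF n1 q this]
        show ?thesis unfolding P_def L_def .
      qed
    qed
    ultimately show ?thesis
      by (subst has_bochner_integral_cong_AE[symmetric]) auto
  qed
  then have "has_bochner_integral lborel
      (\<lambda>g. \<Sum>k\<in>B. erlang_density (n 1 - 1) 1 g * (\<Prod>l=2..m. (g * q l) ^ k l * exp (- (g * q l)) / fact (k l))) (\<Sum>k\<in>B. P k)"
    by (intro has_bochner_integral_sum) auto
  also have "(\<lambda>g. \<Sum>k\<in>B. erlang_density (n 1 - 1) 1 g * (\<Prod>l=2..m. (g * q l) ^ k l * exp (- (g * q l)) / fact (k l))) =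
      (\<lambda>g. erlang_density (n 1 - 1) 1 g * (\<Prod>l=2..m. poisson_lt (n l) (g * q l)))"
    \<comment> \<open>Distributivity: a product of sums over \<open>{..<n l}\<close> is the sum over
      the box \<open>B\<close> of the products.\<close>
    unfolding poisson_lt_def B_def by (subst prod_sum_PiE) (auto simp: sum_distrib_left)
  finally show ?thesis by (simp only: pi1 q_def)
qed

section \<open>The limit in the last parameter\<close>

lemma prod_2_split: "2 \<le> m \<Longrightarrow> (\<Prod>k=2..m::nat. f k) = (\<Prod>k=2..m-1. f k) * f m"
  by (cases m) auto

text \<open>Dominated convergence under the mixture integral. \<open>W\<close> gathers all factors
  that do not involve the last parameter; the Gamma density of \<open>g\<close> dominates, as every
  Poisson factor lies between 0 and 1.\<close>

lemma pi1_tendsto_mixture: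
  assumes "2 \<le> m" "\<And>k. k \<in> {1..m} \<Longrightarrow> 1 \<le> n k"
  defines "W \<equiv> \<lambda>g. erlang_density (n 1 - 1) 1 g * (\<Prod>l=2..m-1. poisson_lt (n l) (g * (real (n l) / real (n 1))))"
  shows "(\<lambda>N. pi1 m (n(m := N))) \<longlonglongrightarrow> (\<integral>g. W g * indicator {..real (n 1)} g \<partial>lborel)"
proof -
  have n1: "1 \<le> n 1" using assms by auto
  have W0: "g < 0 \<Longrightarrow> W g = 0" for g by (simp add: W_def erlang_density_def)
  have bound: "\<bar>W g\<bar> \<le> erlang_density (n 1 - 1) 1 g" for g
  proof (cases "0 \<le> g")
    case True
    then have "0 \<le> (\<Prod>l=2..m-1. poisson_lt (n l) (g * (real (n l) / real (n 1))))"
        "(\<Prod>l=2..m-1. poisson_lt (n l) (g * (real (n l) / real (n 1)))) \<le> 1"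
      by (intro prod_nonneg prod_le_1 ballI conjI poisson_lt_nonneg poisson_lt_le_1; simp)+
    then show ?thesis
      by (simp add: W_def abs_mult mult_left_le)
  qed (simp add: W0)
  have [measurable]: "W \<in> borel_measurable borel" unfolding W_def by measurable
  \<comment> \<open>The last Poisson mean is written as \<open>N\<close> times
    \<open>c = g / n 1\<close>, the shape in which the concentration lemma applies.\<close>
  have "(\<lambda>N. \<integral>g. W g * poisson_lt N (real N * (g / real (n 1))) \<partial>lborel) \<longlonglongrightarrow>
      (\<integral>g. W g * indicator {..real (n 1)} g \<partial>lborel)"
  proof (rule integral_dominated_convergence)
    show "integrable lborel (erlang_density (n 1 - 1) 1)"
      using has_bochner_integral_erlang_density[of 1 "n 1 - 1"] by (simp add: has_bochner_integral_iff)
    show "AE g in lborel. (\<lambda>N. W g * poisson_lt N (real N * (g / real (n 1)))) \<longlonglongrightarrow> W g * indicator {..real (n 1)} g"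
      \<comment> \<open>Discards the critical point \<open>c = 1\<close>.\<close>
      using AE_lborel_singleton[of "real (n 1)"]
    proof eventually_elim
      case (elim g)
      show ?case
      proof (cases "g < 0")
        case False
        then have "(\<lambda>N. poisson_lt N (real N * (g / real (n 1)))) \<longlonglongrightarrow> (if g / real (n 1) < 1 then 1 else 0)"
          using elim n1 by (intro poisson_lt_tendsto) auto
        also have "(if g / real (n 1) < 1 then 1 else 0) = (indicator {..real (n 1)} g :: real)"
          using elim n1 by (auto split: split_indicator)
        finally show ?thesis by (intro tendsto_mult tendsto_const)
      qed (simp add: W0)
    qed
    show "AE g in lborel. norm (W g * poisson_lt N (real N * (g / real (n 1)))) \<le> erlang_density (n 1 - 1) 1 g" for N
    proof (rule AE_I2)
      fix g :: real
      show "norm (W g * poisson_lt N (real N * (g / real (n 1)))) \<le> erlang_density (n 1 - 1) 1 g"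
      proof (cases "0 \<le> g")
        case True
        then have "\<bar>W g\<bar> * \<bar>poisson_lt N (real N * (g / real (n 1)))\<bar> \<le> erlang_density (n 1 - 1) 1 g * 1"
          by (intro mult_mono bound) (auto simp: poisson_lt_nonneg poisson_lt_le_1)
        then show ?thesis by (simp add: abs_mult)
      qed (simp add: W0)
    qed
  qed measurable
  \<comment> \<open>The mixture formula asks for positive parameters, hence \<open>N\<close> at
    least 1. Since \<open>m\<close> is at least 2, the update at \<open>m\<close> affects neither
    \<open>n 1\<close> nor the factors in \<open>W\<close>.\<close>
  moreover have "pi1 m (n(m := N)) = (\<integral>g. W g * poisson_lt N (real N * (g / real (n 1))) \<partial>lborel)" if "1 \<le> N" for N
  proof -
    have "has_bochner_integral lborel
      (\<lambda>g. erlang_density ((n(m := N)) 1 - 1) 1 g *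
        (\<Prod>l=2..m. poisson_lt ((n(m := N)) l) (g * (real ((n(m := N)) l) / real ((n(m := N)) 1)))))
      (pi1 m (n(m := N)))"
      using assms(1,2) that by (intro has_bochner_integral_pi1) auto
    also have "(\<lambda>g. erlang_density ((n(m := N)) 1 - 1) 1 g *
        (\<Prod>l=2..m. poisson_lt ((n(m := N)) l) (g * (real ((n(m := N)) l) / real ((n(m := N)) 1))))) =
      (\<lambda>g. W g * poisson_lt N (real N * (g / real (n 1))))"
    proof -
      have "(\<Prod>l=2..m-1. poisson_lt ((n(m := N)) l) (g * (real ((n(m := N)) l) / real (n 1)))) =
          (\<Prod>l=2..m-1. poisson_lt (n l) (g * (real (n l) / real (n 1))))" for g
        using assms(1) by (intro prod.cong) auto
      then show ?thesis
        using assms(1) unfolding W_def by (simp add: prod_2_split[OF assms(1)] mult.assoc mult.commute[of "real N"])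
    qed
    finally show ?thesis by (simp only: has_bochner_integral_iff)
  qed
  ultimately show ?thesis
    by (elim Lim_transform_eventually) (auto intro!: eventually_mono[OF eventually_ge_at_top[of 1]])
qed

section \<open>The inverted Dirichlet density as a Gamma mixture\<close>

lemma borel_measurable_inverted_dirichlet_density [measurable]:
  "inverted_dirichlet_density m n \<in> borel_measurable (PiM {2..m} (\<lambda>_. lborel))"
  unfolding inverted_dirichlet_density_def by measurable

lemma Gamma_of_nat_nonneg: "0 \<le> Gamma (real k)"
  by (cases "k = 0") (auto intro: Gamma_real_nonneg)

lemma inverted_dirichlet_density_nonneg: "0 \<le> inverted_dirichlet_density m n s"
proof (cases "\<forall>k\<in>{2..m}. 0 \<le> s k")
  case True
  then have "0 \<le> (\<Sum>k=2..m. s k)" "0 \<le> (\<Prod>k=2..m. s k ^ (n k - 1))" "0 \<le> (\<Prod>k=1..m. Gamma (real (n k)))"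
    by (auto intro!: sum_nonneg prod_nonneg Gamma_of_nat_nonneg)
  then show ?thesis
    by (simp add: inverted_dirichlet_density_def Gamma_of_nat_nonneg del: of_nat_sum)
qed (auto simp: inverted_dirichlet_density_def)

lemma inverted_dirichlet_density_eq_0: "\<not> (\<forall>k\<in>{2..m}. 0 \<le> s k) \<Longrightarrow> inverted_dirichlet_density m n s = 0"
  by (auto simp: inverted_dirichlet_density_def)

text \<open>Integrates the joint density over \<open>g\<close> in \<open>A\<close>, with the part
  depending on \<open>s\<close> alone pulled out. \<open>A = UNIV\<close> recovers the density
  itself; \<open>A = {..c}\<close> produces the Gamma distribution function in the limit.\<close>

lemma nn_integral_mixture_eq_inverted_dirichlet:
  assumes "1 \<le> m" "\<And>k. k \<in> {1..m} \<Longrightarrow> 1 \<le> n k" and [measurable]: "A \<in> sets borel"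
  shows "(\<integral>\<^sup>+g. ennreal (erlang_density (n 1 - 1) 1 g * (\<Prod>k=2..m. erlang_density (n k - 1) g (s k))) * indicator A g \<partial>lborel) =
    ennreal (inverted_dirichlet_density m n s) *
      (\<integral>\<^sup>+g. ennreal (erlang_density ((\<Sum>k=1..m. n k) - 1) (1 + (\<Sum>k=2..m. s k)) g) * indicator A g \<partial>lborel)"
proof -
  have "(\<integral>\<^sup>+g. ennreal (erlang_density (n 1 - 1) 1 g * (\<Prod>k=2..m. erlang_density (n k - 1) g (s k))) * indicator A g \<partial>lborel) =
     (\<integral>\<^sup>+g. ennreal (inverted_dirichlet_density m n s) *
        (ennreal (erlang_density ((\<Sum>k=1..m. n k) - 1) (1 + (\<Sum>k=2..m. s k)) g) * indicator A g) \<partial>lborel)"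
  proof (intro nn_integral_cong_AE)
    show "AE g in lborel. ennreal (erlang_density (n 1 - 1) 1 g * (\<Prod>k=2..m. erlang_density (n k - 1) g (s k))) * indicator A g =
        ennreal (inverted_dirichlet_density m n s) *
        (ennreal (erlang_density ((\<Sum>k=1..m. n k) - 1) (1 + (\<Sum>k=2..m. s k)) g) * indicator A g)"
      using AE_lborel_singleton[of 0]
    proof eventually_elim
      case (elim g)
      show ?case
      proof (cases "g < 0")
        case True
        then show ?thesis by (simp add: erlang_density_def)
      next
        case False
        with elim have g: "0 < g" by simp
        show ?thesis
          using erlang_density_prod_eq_inverted_dirichlet[of m n g s] assms(1,2) g
          by (simp only: ennreal_mult'[OF inverted_dirichlet_density_nonneg] mult.assoc)
      qed
    qed
  qed
  then show ?thesis by (simp add: nn_integral_cmult)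
qed

lemma inverted_dirichlet_eq_nn_integral_mixture:
  assumes "1 \<le> m" "\<And>k. k \<in> {1..m} \<Longrightarrow> 1 \<le> n k"
  shows "ennreal (inverted_dirichlet_density m n s) =
    (\<integral>\<^sup>+g. ennreal (erlang_density (n 1 - 1) 1 g * (\<Prod>k=2..m. erlang_density (n k - 1) g (s k))) \<partial>lborel)"
proof (cases "\<forall>k\<in>{2..m}. 0 \<le> s k")
  case True
  then have "0 < 1 + (\<Sum>k=2..m. s k)" by (intro add_pos_nonneg sum_nonneg) auto
  then show ?thesis
    using nn_integral_mixture_eq_inverted_dirichlet[of m n, OF assms, where A=UNIV and s=s]
    by (simp add: nn_integral_erlang_density_UNIV)
next
  case False
  then show ?thesis
    using nn_integral_mixture_eq_inverted_dirichlet[of m n, OF assms, where A=UNIV and s=s]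
    by (simp add: inverted_dirichlet_density_eq_0)
qed

text \<open>In the mixture representation only one factor contains the last coordinate, and it
  integrates to 1 for every positive \<open>g\<close>. After Fubini the mixture for
  \<open>m - 1\<close> is left, so no integral of rational functions has to be evaluated.\<close>

lemma nn_integral_inverted_dirichlet_last:
  assumes "2 \<le> m" "\<And>k. k \<in> {1..m} \<Longrightarrow> 1 \<le> n k"
  shows "(\<integral>\<^sup>+y. ennreal (inverted_dirichlet_density m n (s(m := y))) \<partial>lborel) =
    ennreal (inverted_dirichlet_density (m - 1) n s)"
proof -
  define w where "w g = erlang_density (n 1 - 1) 1 g * (\<Prod>k=2..m-1. erlang_density (n k - 1) g (s k))" for g
  have m: "1 \<le> m" "1 \<le> m - 1" using assms(1) by auto
  have [measurable]: "w \<in> borel_measurable borel" unfolding w_def erlang_density_def by measurable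
  have w0: "g < 0 \<Longrightarrow> w g = 0" for g by (simp add: w_def erlang_density_def)
  have wnn: "0 \<le> w g" for g
    by (cases "0 \<le> g") (simp_all add: w0, simp add: w_def prod_nonneg)
  have split: "erlang_density (n 1 - 1) 1 g * (\<Prod>k=2..m. erlang_density (n k - 1) g ((s(m := y)) k)) =
      w g * erlang_density (n m - 1) g y" for g y
  proof -
    have "(\<Prod>k=2..m-1. erlang_density (n k - 1) g ((s(m := y)) k)) = (\<Prod>k=2..m-1. erlang_density (n k - 1) g (s k))"
      using assms(1) by (intro prod.cong) auto
    then show ?thesis by (simp add: prod_2_split[OF assms(1)] w_def)
  qed
  have "(\<integral>\<^sup>+y. ennreal (inverted_dirichlet_density m n (s(m := y))) \<partial>lborel) =
      (\<integral>\<^sup>+y. \<integral>\<^sup>+g. ennreal (w g * erlang_density (n m - 1) g y) \<partial>lborel \<partial>lborel)"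
    using inverted_dirichlet_eq_nn_integral_mixture[of m n] m(1) assms(2) by (simp only: split)
  also have "\<dots> = (\<integral>\<^sup>+g. \<integral>\<^sup>+y. ennreal (w g * erlang_density (n m - 1) g y) \<partial>lborel \<partial>lborel)"
    unfolding erlang_density_def by (intro lborel_pair.Fubini') measurable
  also have "\<dots> = (\<integral>\<^sup>+g. ennreal (w g) \<partial>lborel)"
  proof (intro nn_integral_cong_AE)
    show "AE g in lborel. (\<integral>\<^sup>+y. ennreal (w g * erlang_density (n m - 1) g y) \<partial>lborel) = ennreal (w g)"
      using AE_lborel_singleton[of 0]
    proof eventually_elim
      case (elim g)
      show ?case
      proof (cases "g < 0")
        case False
        with elim show ?thesis
          by (simp add: ennreal_mult' wnn nn_integral_cmult nn_integral_erlang_density_UNIV)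
      qed (simp add: w0)
    qed
  qed
  also have "\<dots> = ennreal (inverted_dirichlet_density (m - 1) n s)"
    using assms(2) unfolding w_def by (intro inverted_dirichlet_eq_nn_integral_mixture[OF m(2), symmetric]) auto
  finally show ?thesis .
qed

text \<open>Each Poisson factor is a Gamma tail, so their product is an integral over the box
  \<open>A\<close> at fixed \<open>g\<close>. Exchanging the integrals and disintegrating the other
  way leaves the probability that \<open>g\<close> is at most \<open>c\<close> given
  \<open>s\<close>.\<close>

lemma nn_integral_mixture_eq_nn_integral_PiM:
  assumes "1 \<le> m" "\<And>k. k \<in> {1..m} \<Longrightarrow> 1 \<le> n k"
  defines "A \<equiv> \<Pi>\<^sub>E k\<in>{2..m}. {real (n k) / real (n 1) ..}"
  shows "(\<integral>\<^sup>+g. ennreal (erlang_density (n 1 - 1) 1 g *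
        (\<Prod>l=2..m. poisson_lt (n l) (g * (real (n l) / real (n 1))))) * indicator {..c} g \<partial>lborel) =
    (\<integral>\<^sup>+s. ennreal (inverted_dirichlet_density m n s * erlang_CDF ((\<Sum>k=1..m. n k) - 1) (1 + (\<Sum>k=2..m. s k)) c) * indicator A s
       \<partial>PiM {2..m} (\<lambda>_. lborel))"
proof -
  interpret P: product_sigma_finite "\<lambda>_::nat. lborel :: real measure" by standard
  interpret PJ: sigma_finite_measure "PiM {2..m} (\<lambda>_::nat. lborel :: real measure)"
    by (rule P.sigma_finite) simp
  interpret Q: pair_sigma_finite "PiM {2..m} (\<lambda>_::nat. lborel :: real measure)" "lborel :: real measure" ..
  define q where "q k = real (n k) / real (n 1)" for k
  define w where "w g s = erlang_density (n 1 - 1) 1 g * (\<Prod>k=2..m. erlang_density (n k - 1) g (s k))" for g and s :: "nat \<Rightarrow> real"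
  have q: "0 \<le> q k" for k by (simp add: q_def)
  have A: "A = (\<Pi>\<^sub>E k\<in>{2..m}. {q k..})" by (simp add: A_def q_def)
  have [measurable]: "A \<in> sets (PiM {2..m} (\<lambda>_. lborel))"
    unfolding A by (intro sets_PiM_I_finite) auto
  have [measurable]: "(\<lambda>x. w (snd x) (fst x)) \<in> borel_measurable (PiM {2..m} (\<lambda>_. lborel) \<Otimes>\<^sub>M lborel)"
    unfolding w_def erlang_density_def by measurable
  \<comment> \<open>Extensionality of \<open>s\<close> is required: membership in \<open>A\<close>
    also constrains the values outside \<open>{2..m}\<close>.\<close>
  have ind: "(\<Prod>k=2..m. indicator {q k..} (s k)) = (indicator A s :: ennreal)" if "s \<in> {2..m} \<rightarrow>\<^sub>E UNIV" for s
  proof (cases "s \<in> A")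
    case True
    then show ?thesis by (auto simp: A PiE_iff intro!: prod.neutral)
  next
    case False
    then obtain k where "k \<in> {2..m}" "s k \<notin> {q k..}"
      using \<open>s \<in> {2..m} \<rightarrow>\<^sub>E UNIV\<close> by (auto simp: A PiE_iff)
    then have "(\<Prod>k=2..m. indicator {q k..} (s k)) = (0 :: ennreal)"
      by (intro prod_zero bexI[of _ k]) auto
    then show ?thesis using False by simp
  qed
  have "(\<integral>\<^sup>+g. ennreal (erlang_density (n 1 - 1) 1 g * (\<Prod>l=2..m. poisson_lt (n l) (g * q l))) * indicator {..c} g \<partial>lborel) =
     (\<integral>\<^sup>+g. \<integral>\<^sup>+s. ennreal (w g s) * indicator {..c} g * indicator A s \<partial>PiM {2..m} (\<lambda>_. lborel) \<partial>lborel)"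
  proof (intro nn_integral_cong_AE)
    show "AE g in lborel. ennreal (erlang_density (n 1 - 1) 1 g * (\<Prod>l=2..m. poisson_lt (n l) (g * q l))) * indicator {..c} g =
      (\<integral>\<^sup>+s. ennreal (w g s) * indicator {..c} g * indicator A s \<partial>PiM {2..m} (\<lambda>_. lborel))"
      using AE_lborel_singleton[of 0]
    proof eventually_elim
      case (elim g)
      show ?case
      proof (cases "g < 0")
        case True
        then show ?thesis by (simp add: erlang_density_def w_def)
      next
        case False
        with elim have g: "0 < g" by simp
        have [measurable]: "w g \<in> borel_measurable (PiM {2..m} (\<lambda>_. lborel))"
          unfolding w_def by measurable
        have "ennreal (\<Prod>l=2..m. poisson_lt (n l) (g * q l)) = (\<Prod>l=2..m. ennreal (poisson_lt (n l) (g * q l)))"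
          using g q by (intro prod_ennreal[symmetric] poisson_lt_nonneg) auto
        also have "\<dots> = (\<Prod>l=2..m. \<integral>\<^sup>+y. ennreal (erlang_density (n l - 1) g y) * indicator {q l..} y \<partial>lborel)"
        proof (intro prod.cong refl)
          fix l assume "l \<in> {2..m}"
          then have "Suc (n l - 1) = n l" using assms(2)[of l] by auto
          then show "ennreal (poisson_lt (n l) (g * q l)) = (\<integral>\<^sup>+y. ennreal (erlang_density (n l - 1) g y) * indicator {q l..} y \<partial>lborel)"
            using nn_integral_erlang_density_atLeast[OF g q, of "n l - 1" l] by simp
        qed
        also have "\<dots> = (\<integral>\<^sup>+s. (\<Prod>l=2..m. ennreal (erlang_density (n l - 1) g (s l)) * indicator {q l..} (s l)) \<partial>PiM {2..m} (\<lambda>_. lborel))"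
          by (intro P.product_nn_integral_prod[symmetric]) auto
        also have "\<dots> = (\<integral>\<^sup>+s. ennreal (\<Prod>l=2..m. erlang_density (n l - 1) g (s l)) * indicator A s \<partial>PiM {2..m} (\<lambda>_. lborel))"
          using g by (intro nn_integral_cong) (simp add: prod.distrib prod_ennreal space_PiM ind)
        finally have "ennreal (erlang_density (n 1 - 1) 1 g * (\<Prod>l=2..m. poisson_lt (n l) (g * q l))) * indicator {..c} g =
          (ennreal (erlang_density (n 1 - 1) 1 g) * indicator {..c} g) *
            (\<integral>\<^sup>+s. ennreal (\<Prod>l=2..m. erlang_density (n l - 1) g (s l)) * indicator A s \<partial>PiM {2..m} (\<lambda>_. lborel))"
          by (simp add: ennreal_mult' ac_simps)
        also have "\<dots> = (\<integral>\<^sup>+s. (ennreal (erlang_density (n 1 - 1) 1 g) * indicator {..c} g) *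
            (ennreal (\<Prod>l=2..m. erlang_density (n l - 1) g (s l)) * indicator A s) \<partial>PiM {2..m} (\<lambda>_. lborel))"
          by (intro nn_integral_cmult[symmetric]) measurable
        finally show ?thesis
          by (simp add: w_def ennreal_mult' ac_simps)
      qed
    qed
  qed
  also have "\<dots> = (\<integral>\<^sup>+s. \<integral>\<^sup>+g. ennreal (w g s) * indicator {..c} g * indicator A s \<partial>lborel \<partial>PiM {2..m} (\<lambda>_. lborel))"
    by (intro Q.Fubini') (simp add: split_beta')
  also have "\<dots> = (\<integral>\<^sup>+s. ennreal (inverted_dirichlet_density m n s * erlang_CDF ((\<Sum>k=1..m. n k) - 1) (1 + (\<Sum>k=2..m. s k)) c) * indicator A s
       \<partial>PiM {2..m} (\<lambda>_. lborel))"
  proof (intro nn_integral_cong)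
    fix s :: "nat \<Rightarrow> real"
    have [measurable]: "(\<lambda>g. w g s) \<in> borel_measurable borel" unfolding w_def erlang_density_def by measurable
    show "(\<integral>\<^sup>+g. ennreal (w g s) * indicator {..c} g * indicator A s \<partial>lborel) =
       ennreal (inverted_dirichlet_density m n s * erlang_CDF ((\<Sum>k=1..m. n k) - 1) (1 + (\<Sum>k=2..m. s k)) c) * indicator A s"
    proof (cases "s \<in> A")
      case True
      \<comment> \<open>On the box the coordinates are nonnegative, so the conditional rate of
        \<open>g\<close> is positive and its distribution function is the Erlang one.\<close>
      have "0 \<le> s k" if "k \<in> {2..m}" for k
        using True that order_trans[OF q[of k], of "s k"] by (auto simp: A PiE_iff)
      then have "0 < 1 + (\<Sum>k=2..m. s k)" by (intro add_pos_nonneg sum_nonneg) auto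
      then show ?thesis
        using nn_integral_mixture_eq_inverted_dirichlet[of m n "{..c}" s] assms(1,2) True
        by (simp add: w_def nn_integral_erlang_density ennreal_mult' inverted_dirichlet_density_nonneg)
    qed simp
  qed
  finally show ?thesis by (simp only: q_def)
qed

section \<open>The inner Gamma integral and the marginal density\<close>

lemma set_integral_gamma_density:
  assumes "1 \<le> S" "0 \<le> b"
  shows "(LINT x : {0..b} | lborel. gamma_density (real S) x) = erlang_CDF (S - 1) 1 b"
proof -
  have "(LINT x : {0..b} | lborel. gamma_density (real S) x) =
      (\<integral>x. erlang_density (S - 1) 1 x * indicator {..b} x \<partial>lborel)"
    unfolding set_lebesgue_integral_def
  proof (intro integral_cong_AE)
    show "AE x in lborel. indicator {0..b} x *\<^sub>R gamma_density (real S) x =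
        erlang_density (S - 1) 1 x * indicator {..b} x"
      \<comment> \<open>At 0 the two densities differ when \<open>S = 1\<close>:
        \<open>gamma_density\<close> is 0 there and the Erlang density is 1. To the left of 0 the
        Erlang density vanishes, so the ray \<open>{..b}\<close> can replace the interval.\<close>
      using AE_lborel_singleton[of 0]
    proof eventually_elim
      case (elim x)
      have "x powr (real S - 1) = x ^ (S - 1)" if "0 < x"
        using that assms(1) powr_realpow[of x "S - 1"] by (simp add: of_nat_diff)
      then show ?case
        using elim assms(1) by (auto simp: gamma_density_def erlang_density_def Gamma_of_nat split: split_indicator)
    qed
  qed (unfold gamma_density_def, measurable)
  also have "\<dots> = enn2real (\<integral>\<^sup>+x. ennreal (erlang_density (S - 1) 1 x * indicator {..b} x) \<partial>lborel)"
    by (intro integral_eq_nn_integral) auto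
  also have "\<dots> = erlang_CDF (S - 1) 1 b"
    by (simp add: ennreal_mult' ennreal_indicator nn_integral_erlang_density)
  finally show ?thesis .
qed

lemma borel_measurable_erlang_CDF [measurable]: "erlang_CDF k l \<in> borel_measurable borel"
  unfolding erlang_CDF_def by measurable

text \<open>The marginal law is the image of the joint law under restriction of the index set;
  splitting off coordinate \<open>m\<close> and integrating it out gives its density.\<close>

lemma (in prob_space) distributed_inverted_dirichlet_marginal:
  assumes "2 \<le> m" "\<And>k. k \<in> {1..m} \<Longrightarrow> 1 \<le> n k"
    and D: "distributed M (PiM {2..m} (\<lambda>_. lborel)) (\<lambda>\<omega>. \<lambda>k\<in>{2..m}. X k \<omega>)
           (\<lambda>s. ennreal (inverted_dirichlet_density m n s))"
  shows "distributed M (PiM {2..m-1} (\<lambda>_. lborel)) (\<lambda>\<omega>. \<lambda>k\<in>{2..m-1}. X k \<omega>)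
           (\<lambda>s. ennreal (inverted_dirichlet_density (m - 1) n s))"
proof -
  interpret P: product_sigma_finite "\<lambda>_::nat. lborel :: real measure" by standard
  let ?N = "PiM {2..m} (\<lambda>_::nat. lborel :: real measure)"
  let ?N' = "PiM {2..m-1} (\<lambda>_::nat. lborel :: real measure)"
  have ins: "{2..m} = insert m {2..m-1}" using assms(1) by auto
  have X [measurable]: "(\<lambda>\<omega>. \<lambda>k\<in>{2..m}. X k \<omega>) \<in> measurable M ?N"
    using D by (rule distributed_measurable)
  have R [measurable]: "(\<lambda>s. restrict s {2..m-1}) \<in> measurable ?N ?N'"
    by (rule measurable_restrict_subset) auto
  have eq: "(\<lambda>\<omega>. \<lambda>k\<in>{2..m-1}. X k \<omega>) = (\<lambda>s. restrict s {2..m-1}) \<circ> (\<lambda>\<omega>. \<lambda>k\<in>{2..m}. X k \<omega>)"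
    by (auto simp: fun_eq_iff restrict_def)
  have "distr M ?N' (\<lambda>\<omega>. \<lambda>k\<in>{2..m-1}. X k \<omega>) =
      distr (density ?N (\<lambda>s. ennreal (inverted_dirichlet_density m n s))) ?N' (\<lambda>s. restrict s {2..m-1})"
    unfolding eq distributed_distr_eq_density[OF D, symmetric] by (rule distr_distr[symmetric]) measurable
  also have "\<dots> = density ?N' (\<lambda>s. ennreal (inverted_dirichlet_density (m - 1) n s))"
  proof (rule measure_eqI)
    fix B assume "B \<in> sets (distr (density ?N (\<lambda>s. ennreal (inverted_dirichlet_density m n s))) ?N' (\<lambda>s. restrict s {2..m-1}))"
    then have B [measurable]: "B \<in> sets ?N'" by simp
    have "emeasure (distr (density ?N (\<lambda>s. ennreal (inverted_dirichlet_density m n s))) ?N' (\<lambda>s. restrict s {2..m-1})) B =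
       (\<integral>\<^sup>+s. ennreal (inverted_dirichlet_density m n s) * indicator ((\<lambda>s. restrict s {2..m-1}) -` B \<inter> space ?N) s \<partial>?N)"
      using R B measurable_sets[OF R B] by (subst emeasure_distr) (auto intro!: emeasure_density)
    also have "\<dots> = (\<integral>\<^sup>+s. ennreal (inverted_dirichlet_density m n s) * indicator B (restrict s {2..m-1}) \<partial>?N)"
      by (intro nn_integral_cong) (auto split: split_indicator)
    also have "\<dots> = (\<integral>\<^sup>+s. \<integral>\<^sup>+y. ennreal (inverted_dirichlet_density m n (s(m := y))) * indicator B (restrict (s(m := y)) {2..m-1}) \<partial>lborel \<partial>?N')"
    proof -
      have "(\<lambda>s. ennreal (inverted_dirichlet_density m n s) * indicator B (restrict s {2..m-1})) \<in> borel_measurable ?N"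
        by measurable
      then show ?thesis
        using assms(1) unfolding ins by (intro P.product_nn_integral_insert) auto
    qed
    also have "\<dots> = (\<integral>\<^sup>+s. ennreal (inverted_dirichlet_density (m - 1) n s) * indicator B s \<partial>?N')"
    proof (intro nn_integral_cong)
      fix s assume s: "s \<in> space ?N'"
      \<comment> \<open>Hence the indicator of \<open>B\<close> is constant in \<open>y\<close> and
        leaves the inner integral.\<close>
      then have "restrict (s(m := y)) {2..m-1} = s" for y
        using assms(1) by (auto simp: space_PiM PiE_iff fun_eq_iff restrict_def extensional_def)
      moreover have "(\<lambda>y. s(m := y)) \<in> measurable lborel ?N"
        using s assms(1) unfolding ins by (intro measurable_fun_upd[where J="{2..m-1}"]) auto
      ultimately show "(\<integral>\<^sup>+y. ennreal (inverted_dirichlet_density m n (s(m := y))) * indicator B (restrict (s(m := y)) {2..m-1}) \<partial>lborel) =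
          ennreal (inverted_dirichlet_density (m - 1) n s) * indicator B s"
        using nn_integral_inverted_dirichlet_last[of m n s] assms(1,2) by (simp add: nn_integral_multc)
    qed
    also have "\<dots> = emeasure (density ?N' (\<lambda>s. ennreal (inverted_dirichlet_density (m - 1) n s))) B"
      by (intro emeasure_density[symmetric] B) measurable
    finally show "emeasure (distr (density ?N (\<lambda>s. ennreal (inverted_dirichlet_density m n s))) ?N' (\<lambda>s. restrict s {2..m-1})) B =
      emeasure (density ?N' (\<lambda>s. ennreal (inverted_dirichlet_density (m - 1) n s))) B" .
  qed simp
  finally show ?thesis
    unfolding distributed_def eq using measurable_comp[OF X R] by simp
qed

text \<open>The marginal density enters as an arbitrary version \<open>\<phi>\<close>; its
  nonnegativity is assumed because \<open>ennreal\<close> would hide negative values. For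
  \<open>m = 2\<close> the index set \<open>{2..m-1}\<close> is empty and \<open>PiM\<close> is a
  one-point space of mass 1, so the outer integration disappears and \<open>\<phi>\<close> equals 1
  there.\<close>

theorem theorem25:
  fixes m :: nat and n :: "nat \<Rightarrow> nat"
    and M :: "'a measure" and X :: "nat \<Rightarrow> 'a \<Rightarrow> real" and \<phi> :: "(nat \<Rightarrow> real) \<Rightarrow> real"
  assumes "2 \<le> m"
    and "\<And>k. k \<in> {1..m} \<Longrightarrow> 1 \<le> n k"
    and "prob_space M"
    and "distributed M (PiM {2..m} (\<lambda>_. lborel)) (\<lambda>\<omega>. \<lambda>k\<in>{2..m}. X k \<omega>)
           (\<lambda>s. ennreal (inverted_dirichlet_density m n s))"
    and "\<And>s. s \<in> {2..m-1} \<rightarrow>\<^sub>E UNIV \<Longrightarrow> 0 \<le> \<phi> s"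
    and "distributed M (PiM {2..m-1} (\<lambda>_. lborel)) (\<lambda>\<omega>. \<lambda>k\<in>{2..m-1}. X k \<omega>)
           (\<lambda>s. ennreal (\<phi> s))"
  shows "(\<lambda>N. pi1 m (n(m := N))) \<longlonglongrightarrow>
    (LINT s : (\<Pi>\<^sub>E k\<in>{2..m-1}. {real (n k) / real (n 1) ..}) | PiM {2..m-1} (\<lambda>_. lborel).
       (LINT x : {0 .. real (n 1) * (1 + (\<Sum>k=2..m-1. s k))} | lborel.
          gamma_density (real (\<Sum>k=1..m-1. n k)) x) * \<phi> s)"
proof -
  interpret prob_space M by fact
  define A where "A = (\<Pi>\<^sub>E k\<in>{2..m-1}. {real (n k) / real (n 1) ..})"
  define S where "S = (\<Sum>k=1..m-1. n k)"
  define I where "I = inverted_dirichlet_density (m - 1) n"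
  define L where "L s = 1 + (\<Sum>k=2..m-1. s k)" for s :: "nat \<Rightarrow> real"
  define W where "W g = erlang_density (n 1 - 1) 1 g * (\<Prod>l=2..m-1. poisson_lt (n l) (g * (real (n l) / real (n 1))))" for g
  let ?N = "PiM {2..m-1} (\<lambda>_::nat. lborel :: real measure)"
  have m: "1 \<le> m - 1" using assms(1) by auto
  have n: "1 \<le> n k" if "k \<in> {1..m-1}" for k using assms(2) that by auto
  have "n 1 \<le> S" unfolding S_def using m by (intro member_le_sum) auto
  then have S: "1 \<le> S" using n[of 1] m by simp
  have [measurable]: "A \<in> sets ?N"
    unfolding A_def by (intro sets_PiM_I_finite) auto
  have [measurable]: "I \<in> borel_measurable ?N" unfolding I_def by measurable
  have I_nonneg: "0 \<le> I s" for s by (simp add: I_def inverted_dirichlet_density_nonneg)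
  have [measurable]: "\<phi> \<in> borel_measurable ?N"
    using assms(5,6) by (intro distributed_real_measurable) (auto simp: space_PiM)
  have [measurable]: "W \<in> borel_measurable borel" unfolding W_def by measurable
  have W_nonneg: "0 \<le> W g" for g
    by (cases "0 \<le> g") (simp_all add: W_def prod_nonneg poisson_lt_nonneg, simp add: erlang_density_def)
  have [measurable]: "L \<in> borel_measurable ?N" unfolding L_def by measurable
  have L: "1 \<le> L s" if "s \<in> A" for s
  proof -
    have "0 \<le> s k" if "k \<in> {2..m-1}" for k
      using \<open>s \<in> A\<close> that order_trans[of 0 "real (n k) / real (n 1)" "s k"] by (auto simp: A_def PiE_iff)
    then show ?thesis by (auto simp: L_def intro!: sum_nonneg)
  qed
  \<comment> \<open>Densities of one law agree almost everywhere, which suffices under the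
    integral.\<close>
  have "(AE s in ?N. ennreal (\<phi> s) = ennreal (I s))"
    using distributed_inverted_dirichlet_marginal[of m n X] assms(1,2,4,6)
    unfolding I_def by (intro distributed_unique) auto
  then have phi: "AE s in ?N. \<phi> s = I s"
    using AE_space by eventually_elim (use assms(5) I_nonneg in \<open>auto simp: space_PiM\<close>)
  have "(LINT s : A | ?N. (LINT x : {0 .. real (n 1) * L s} | lborel. gamma_density (real S) x) * \<phi> s) =
      (LINT s : A | ?N. erlang_CDF (S - 1) 1 (real (n 1) * L s) * \<phi> s)"
    unfolding set_lebesgue_integral_def[of ?N]
  proof (intro Bochner_Integration.integral_cong refl)
    fix s
    show "indicator A s *\<^sub>R ((LINT x : {0 .. real (n 1) * L s} | lborel. gamma_density (real S) x) * \<phi> s) =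
      indicator A s *\<^sub>R (erlang_CDF (S - 1) 1 (real (n 1) * L s) * \<phi> s)"
      \<comment> \<open>Off \<open>A\<close> both sides are zero; on \<open>A\<close> the bound on
        \<open>L s\<close> makes the upper limit of integration nonnegative.\<close>
      using L[of s] S by (auto simp: set_integral_gamma_density split: split_indicator)
  qed
  also have "\<dots> = (\<integral>s. indicator A s *\<^sub>R (erlang_CDF (S - 1) 1 (real (n 1) * L s) * I s) \<partial>?N)"
    unfolding set_lebesgue_integral_def
  proof (intro integral_cong_AE)
    show "AE s in ?N. indicator A s *\<^sub>R (erlang_CDF (S - 1) 1 (real (n 1) * L s) * \<phi> s) =
        indicator A s *\<^sub>R (erlang_CDF (S - 1) 1 (real (n 1) * L s) * I s)"
      using phi by eventually_elim simp
  qed measurable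
  also have "\<dots> = enn2real (\<integral>\<^sup>+s. ennreal (indicator A s *\<^sub>R (erlang_CDF (S - 1) 1 (real (n 1) * L s) * I s)) \<partial>?N)"
    by (intro integral_eq_nn_integral) (measurable, simp add: I_nonneg)
  also have "(\<integral>\<^sup>+s. ennreal (indicator A s *\<^sub>R (erlang_CDF (S - 1) 1 (real (n 1) * L s) * I s)) \<partial>?N) =
      (\<integral>\<^sup>+s. ennreal (I s * erlang_CDF (S - 1) (L s) (real (n 1))) * indicator A s \<partial>?N)"
    \<comment> \<open>Scaling: rate 1 up to \<open>n 1 * L s\<close> gives the same probability as
      rate \<open>L s\<close> up to \<open>n 1\<close>. The latter is the form that Fubini
      produced.\<close>
    using L by (intro nn_integral_cong)
      (force simp: erlang_CDF_transform[of "L _"] mult.commute split: split_indicator)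
  also have "\<dots> = (\<integral>\<^sup>+g. ennreal (W g) * indicator {..real (n 1)} g \<partial>lborel)"
    unfolding I_def S_def L_def A_def W_def
    using n by (intro nn_integral_mixture_eq_nn_integral_PiM[OF m, symmetric]) auto
  also have "enn2real \<dots> = enn2real (\<integral>\<^sup>+g. ennreal (W g * indicator {..real (n 1)} g) \<partial>lborel)"
    by (simp add: ennreal_mult' W_nonneg ennreal_indicator)
  also have "\<dots> = (\<integral>g. W g * indicator {..real (n 1)} g \<partial>lborel)"
    by (intro integral_eq_nn_integral[symmetric]) (auto simp: W_nonneg)
  finally show ?thesis
    using pi1_tendsto_mixture[of m n] assms(1,2) unfolding A_def S_def L_def W_def by simp
qed

end
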